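(* Let $\Omega\subset\mathbb{R}^D$ be a bounded domain with positive volume $|\Omega|>0$. Let $(\mathbf{x}_n)_{n\in\mathbb{N}}$ be an equidistributed sequence (of distinct points) in $\Omega$ and $X_N=\{\mathbf{x}_n\}_{n=1}^N$. Furthermore, let $\omega\equiv 1$, let $\varphi:\mathbb{R}_0^+\to\mathbb{R}$ be a radial basis function (RBF) satisfying (R1) $\varphi$ is nonnegative, i.e. $\varphi\ge 0$; (R2) $\varphi$ is uniformly bounded, where without loss of generality $\max_{r\in\mathbb{R}_0^+}|\varphi(r)|=1$; (R3) $\varphi$ is compactly supported, where without loss of generality $\operatorname{supp}\varphi=[0,1]$; and choose the shape parameters $\varepsilon_n$ such that the corresponding functions $\varphi_n(\boldsymbol{x})=\varphi(\varepsilon_n\|\mathbf{x}_n-\boldsymbol{x}\|_2)$ have nonoverlapping support and equal moments ($I[\varphi_n]=I[\varphi_m]$ for all $n,m=1,\dots,N$). Then for every polynomial degree $d\in\mathbb{N}$ there exists an $N_0\in\mathbb{N}$ such that for all $N\ge N_0$ the corresponding RBF cubature formula $C_N[f]=\sum_{n=1}^N w_n f(\mathbf{x}_n)$ with $w_n=I[c_n]$ is stable. That is, $I[c_m]\ge 0$ for all $m=1,\dots,N$, where $c_1,\dots,c_N$ are the cardinal functions.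
   Context: Notation: $I[g]=\int_\Omega g(\boldsymbol{x})\omega(\boldsymbol{x})\,d\boldsymbol{x}$, here with $\omega\equiv1$. $\mathbb{P}_d(\Omega)$ is the space of all algebraic polynomials up to degree $d$ on $\Omega$, and $K=\dim\mathbb{P}_d(\Omega)$. Equidistributed: $(\mathbf{x}_n)_{n\in\mathbb{N}}$ is equidistributed in $\Omega$ if and only if $\lim_{N\to\infty}\frac{|\Omega|}{N}\sum_{n=1}^N g(\mathbf{x}_n)=\int_\Omega g(\boldsymbol{x})\,d\boldsymbol{x}$ for all measurable bounded functions $g:\Omega\to\mathbb{R}$ that are continuous almost everywhere (in the sense of Lebesgue). Support: (R3) gives $\operatorname{supp}\varphi_n=B_{\varepsilon_n^{-1}}(\mathbf{x}_n)=\{\mathbf{x}\in\Omega:\|\mathbf{x}_n-\mathbf{x}\|_2\le\varepsilon_n^{-1}\}$. Nonoverlapping support means that the supports of different $\varphi_n$ do not overlap; the condition given to ensure this is $\varepsilon_n^{-1}\le h_n:=\min\{\|\mathbf{x}_n-\mathbf{x}_m\|_2:\mathbf{x}_m\in X_N\setminus\{\mathbf{x}_n\}\}$ for $n=1,\dots,N$. Cardinal functions: given a basis $p_1,\dots,p_K$ of $\mathbb{P}_d(\Omega)$, the cardinal functions are $$c_m(\boldsymbol{x})=\sum_{n=1}^N\alpha_n^{(m)}\varphi_n(\boldsymbol{x})+\sum_{k=1}^K\beta_k^{(m)}p_k(\boldsymbol{x}),\qquad m=1,\dots,N,$$ determined by $c_m(\mathbf{x}_n)=\delta_{mn}$ for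 $n=1,\dots,N$ and $\sum_{n=1}^N\alpha_n^{(m)}p_k(\mathbf{x}_n)=0$ for $k=1,\dots,K$. Stability: $C_N$ is called stable if $\|C_N\|_\infty=\sum_{n=1}^N|w_n|$ equals $C_N[1]$, which is the case if and only if $I[c_n]\ge0$ for all $n=1,\dots,N$. *)

theory Defs
  imports "HOL-Analysis.Analysis"
begin

text \<open>Sequences of points and finite families are indexed from 1, so index 0 is never used.\<close>

text \<open>The functional \<open>I[g]\<close> for the weight function 1.\<close>

definition moment :: "(real^'D) set \<Rightarrow> (real^'D \<Rightarrow> real) \<Rightarrow> real" where
  "moment \<Omega> g = (LINT x:\<Omega>|lebesgue. g x)"

definition equidistributed :: "(nat \<Rightarrow> real^'D) \<Rightarrow> (real^'D) set \<Rightarrow> bool" where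
  "equidistributed x \<Omega> \<longleftrightarrow>
     (\<forall>n\<ge>1. x n \<in> \<Omega>) \<and>
     (\<forall>g :: real^'D \<Rightarrow> real.
        g \<in> borel_measurable (lebesgue_on \<Omega>) \<and> bounded (g ` \<Omega>) \<and>
        (AE y in lebesgue_on \<Omega>. continuous (at y within \<Omega>) g) \<longrightarrow>
        (\<lambda>N. measure lebesgue \<Omega> / real N * (\<Sum>n=1..N. g (x n))) \<longlonglongrightarrow> moment \<Omega> g)"

text \<open>The support of a function on \<open>S\<close>: the closure, relative to \<open>S\<close>, of the set where it
  does not vanish (the library's \<open>support_on\<close> takes no closure).\<close>

definition supp :: "'a::topological_space set \<Rightarrow> ('a \<Rightarrow> real) \<Rightarrow> 'a set" where
  "supp S f = S \<inter> closure (support_on S f)"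

definition rbf :: "(real \<Rightarrow> real) \<Rightarrow> (nat \<Rightarrow> real) \<Rightarrow> (nat \<Rightarrow> real^'D) \<Rightarrow> nat \<Rightarrow> real^'D \<Rightarrow> real" where
  "rbf \<phi> e x n y = \<phi> (e n * norm (x n - y))"

text \<open>Two supports do not overlap if they have no common interior point; they may touch.\<close>

definition nonoverlapping_supports ::
    "(real^'D) set \<Rightarrow> (nat \<Rightarrow> real^'D \<Rightarrow> real) \<Rightarrow> nat \<Rightarrow> bool" where
  "nonoverlapping_supports \<Omega> f N \<longleftrightarrow>
     (\<forall>n\<in>{1..N}. \<forall>m\<in>{1..N}. n \<noteq> m \<longrightarrow>
        interior (supp \<Omega> (f n)) \<inter> interior (supp \<Omega> (f m)) = {})"

text \<open>Integrability makes the moments meaningful: the integral of a function that is not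
  integrable is 0 by convention.\<close>

definition equal_moments ::
    "(real^'D) set \<Rightarrow> (nat \<Rightarrow> real^'D \<Rightarrow> real) \<Rightarrow> nat \<Rightarrow> bool" where
  "equal_moments \<Omega> f N \<longleftrightarrow>
     (\<forall>n\<in>{1..N}. set_integrable lebesgue \<Omega> (f n)) \<and>
     (\<forall>n\<in>{1..N}. \<forall>m\<in>{1..N}. moment \<Omega> (f n) = moment \<Omega> (f m))"

text \<open>The space of polynomials of total degree at most \<open>d\<close> on \<open>\<Omega>\<close>.  A function on \<open>\<Omega>\<close> is
  represented by any total function with the given values on \<open>\<Omega>\<close>, here and below.\<close>

definition polys_on :: "nat \<Rightarrow> (real^'D) set \<Rightarrow> (real^'D \<Rightarrow> real) set" where
  "polys_on d \<Omega> = {p. \<exists>a :: ('D \<Rightarrow> nat) \<Rightarrow> real. \<forall>y\<in>\<Omega>.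
     p y = (\<Sum>\<gamma> | sum \<gamma> UNIV \<le> d. a \<gamma> * (\<Prod>i\<in>UNIV. (y $ i) ^ \<gamma> i))}"

definition poly_basis :: "nat \<Rightarrow> (real^'D) set \<Rightarrow> nat \<Rightarrow> (nat \<Rightarrow> real^'D \<Rightarrow> real) \<Rightarrow> bool" where
  "poly_basis d \<Omega> K p \<longleftrightarrow>
     (\<forall>k\<in>{1..K}. p k \<in> polys_on d \<Omega>) \<and>
     (\<forall>b. (\<forall>y\<in>\<Omega>. (\<Sum>k=1..K. b k * p k y) = 0) \<longrightarrow> (\<forall>k\<in>{1..K}. b k = 0)) \<and>
     (\<forall>q\<in>polys_on d \<Omega>. \<exists>b. \<forall>y\<in>\<Omega>. q y = (\<Sum>k=1..K. b k * p k y))"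

definition cardinal_functions ::
    "(real^'D) set \<Rightarrow> (nat \<Rightarrow> real^'D) \<Rightarrow> nat \<Rightarrow> (nat \<Rightarrow> real^'D \<Rightarrow> real) \<Rightarrow>
     nat \<Rightarrow> (nat \<Rightarrow> real^'D \<Rightarrow> real) \<Rightarrow> (nat \<Rightarrow> real^'D \<Rightarrow> real) \<Rightarrow> bool" where
  "cardinal_functions \<Omega> x N f K p c \<longleftrightarrow>
     (\<exists>\<alpha> \<beta> :: nat \<Rightarrow> nat \<Rightarrow> real. \<forall>m\<in>{1..N}.
        (\<forall>y\<in>\<Omega>. c m y = (\<Sum>n=1..N. \<alpha> m n * f n y) + (\<Sum>k=1..K. \<beta> m k * p k y)) \<and>
        (\<forall>n\<in>{1..N}. c m (x n) = (if m = n then 1 else 0)) \<and>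
        (\<forall>k\<in>{1..K}. (\<Sum>n=1..N. \<alpha> m n * p k (x n)) = 0))"

definition cubature ::
    "(nat \<Rightarrow> real^'D) \<Rightarrow> nat \<Rightarrow> (nat \<Rightarrow> real) \<Rightarrow> (real^'D \<Rightarrow> real) \<Rightarrow> real" where
  "cubature x N w g = (\<Sum>n=1..N. w n * g (x n))"

definition stable :: "(nat \<Rightarrow> real^'D) \<Rightarrow> nat \<Rightarrow> (nat \<Rightarrow> real) \<Rightarrow> bool" where
  "stable x N w \<longleftrightarrow> (\<Sum>n=1..N. \<bar>w n\<bar>) = cubature x N w (\<lambda>_. 1)"

end

theory Submission
  imports Defs
begin

text \<open>
  The weights turn out to be those of a discrete least-squares formula, and these tend to the
  equal weights \<open>|\<Omega>| / N\<close>.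

  Since the supports do not overlap, \<open>\<phi>\<^sub>n\<close> vanishes at all centers other than \<open>x\<^sub>n\<close>
  (\<open>rbf_at_centers\<close>).  Let \<open>q\<close> be the polynomial part of the cardinal function \<open>c\<^sub>m\<close> and \<open>\<alpha>\<close> its
  vector of RBF coefficients.  Then \<open>q(x\<^sub>n) + \<phi>(0) \<alpha>\<^sub>n\<close> is the Kronecker delta of \<open>m\<close> and \<open>n\<close>,
  and as \<open>\<alpha>\<close> is orthogonal to all polynomials of degree at most \<open>d\<close>, pairing with such a
  polynomial \<open>r\<close> gives the reproducing property \<open>\<Sum>\<^sub>n q(x\<^sub>n) r(x\<^sub>n) = r(x\<^sub>m)\<close>.  If
  \<open>\<phi>(0) \<noteq> 0\<close>, such a \<open>q\<close> is obtained by projecting the delta orthogonally onto the polynomials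
  (\<open>least_squares_solution_exists\<close>), and dividing the residual by \<open>\<phi>(0)\<close> gives \<open>\<alpha>\<close>; this
  proves that cardinal functions exist.  The moments of the \<open>\<phi>\<^sub>n\<close> are equal and \<open>\<alpha>\<close> is
  orthogonal to the constant 1, so the RBF part of \<open>c\<^sub>m\<close> integrates to 0 and
  \<open>I[c\<^sub>m] = I[q]\<close>.

  It remains to show \<open>I[q] \<ge> 0\<close> for large \<open>N\<close> (\<open>least_squares_weights_nonneg\<close>).  The
  reproducing property with \<open>r = 1\<close> says that the equal-weight rule
  \<open>|\<Omega>|/N \<Sum>\<^sub>n q(x\<^sub>n)\<close> has the value \<open>|\<Omega>|/N\<close>.  Its error on \<open>q\<close> is at most
  \<open>\<eta> \<parallel>q\<parallel>\<close>, where equidistribution makes \<open>\<eta>\<close> arbitrarily small and \<open>\<parallel>q\<parallel>\<close> is a norm of the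
  coefficients.  That norm is itself of order \<open>|\<Omega>|/N\<close>: the reproducing property with \<open>r = q\<close>
  makes the discrete mean square of \<open>q\<close> equal to \<open>|\<Omega>|/N q(x\<^sub>m)\<close>, which is of first order in
  \<open>\<parallel>q\<parallel>\<close>, while it is bounded below by a multiple of \<open>\<parallel>q\<parallel>\<^sup>2\<close>, because the discrete Gram
  matrices converge to the positive definite Gram matrix of \<open>L\<^sup>2(\<Omega>)\<close>.  Hence for
  small \<open>\<eta>\<close> the error does not exceed the main term.
\<close>

section \<open>Least squares over a finite family\<close>

text \<open>The normal equations are solved by one Gram-Schmidt step per family member: the part \<open>w\<close> of
  \<open>v i\<close> orthogonal to the earlier members is removed from the earlier residual \<open>u\<close>.\<close>

lemma least_squares_solution_exists:
  fixes t :: "'a \<Rightarrow> real" and v :: "'i \<Rightarrow> 'a \<Rightarrow> real"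
  assumes "finite A" "finite I"
  shows "\<exists>b. \<forall>k\<in>I. (\<Sum>n\<in>A. (t n - (\<Sum>j\<in>I. b j * v j n)) * v k n) = 0"
  using \<open>finite I\<close>
proof (induction I arbitrary: t rule: finite_induct)
  case empty
  then show ?case by simp
next
  case (insert i I)
  obtain b where b: "\<And>k. k \<in> I \<Longrightarrow> (\<Sum>n\<in>A. (t n - (\<Sum>j\<in>I. b j * v j n)) * v k n) = 0"
    using insert.IH[of t] by blast
  obtain e where e: "\<And>k. k \<in> I \<Longrightarrow> (\<Sum>n\<in>A. (v i n - (\<Sum>j\<in>I. e j * v j n)) * v k n) = 0"
    using insert.IH[of "v i"] by blast
  define u where "u n = t n - (\<Sum>j\<in>I. b j * v j n)" for n
  define w where "w n = v i n - (\<Sum>j\<in>I. e j * v j n)" for n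
  define s where "s = (\<Sum>n\<in>A. u n * w n) / (\<Sum>n\<in>A. w n * w n)"
  define c where "c j = (if j = i then s else b j - s * e j)" for j
  have residual: "t n - (\<Sum>j\<in>insert i I. c j * v j n) = u n - s * w n" for n
  proof -
    have "(\<Sum>j\<in>I. c j * v j n) = (\<Sum>j\<in>I. b j * v j n - s * (e j * v j n))"
      using insert.hyps by (intro sum.cong) (auto simp: c_def algebra_simps)
    then show ?thesis
      using insert.hyps
      by (simp add: u_def w_def c_def sum_subtractf sum_distrib_left algebra_simps)
  qed
  have old: "(\<Sum>n\<in>A. (u n - s * w n) * v k n) = 0" if "k \<in> I" for k
  proof -
    have "(\<Sum>n\<in>A. (u n - s * w n) * v k n) = (\<Sum>n\<in>A. u n * v k n) - s * (\<Sum>n\<in>A. w n * v k n)"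
      by (simp add: sum_subtractf sum_distrib_left algebra_simps)
    then show ?thesis using b[OF that] e[OF that] by (simp add: u_def w_def)
  qed
  \<comment> \<open>If \<open>w\<close> vanishes on \<open>A\<close>, then \<open>s = 0\<close> by the convention for division by 0, and the
    claim holds trivially.\<close>
  have along_w: "(\<Sum>n\<in>A. (u n - s * w n) * w n) = 0"
  proof (cases "(\<Sum>n\<in>A. w n * w n) = 0")
    case True
    then have "\<forall>n\<in>A. w n = 0"
      using \<open>finite A\<close> by (simp add: sum_nonneg_eq_0_iff)
    then show ?thesis by simp
  next
    case False
    have "(\<Sum>n\<in>A. (u n - s * w n) * w n) = (\<Sum>n\<in>A. u n * w n) - s * (\<Sum>n\<in>A. w n * w n)"
      by (simp add: sum_subtractf sum_distrib_left algebra_simps)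
    then show ?thesis using False by (simp add: s_def)
  qed
  have new: "(\<Sum>n\<in>A. (u n - s * w n) * v i n) = 0"
  proof -
    have "(\<Sum>n\<in>A. (u n - s * w n) * v i n)
        = (\<Sum>n\<in>A. (u n - s * w n) * w n + (\<Sum>j\<in>I. e j * ((u n - s * w n) * v j n)))"
    proof (rule sum.cong[OF refl])
      fix n
      have "v i n = w n + (\<Sum>j\<in>I. e j * v j n)" by (simp add: w_def)
      then have "(u n - s * w n) * v i n
          = (u n - s * w n) * w n + (u n - s * w n) * (\<Sum>j\<in>I. e j * v j n)"
        by (metis distrib_left)
      then show "(u n - s * w n) * v i n
          = (u n - s * w n) * w n + (\<Sum>j\<in>I. e j * ((u n - s * w n) * v j n))"
        by (simp add: sum_distrib_left mult.left_commute)
    qed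
    also have "\<dots> = (\<Sum>j\<in>I. \<Sum>n\<in>A. e j * ((u n - s * w n) * v j n))"
      using along_w sum.swap[of "\<lambda>n j. e j * ((u n - s * w n) * v j n)" I A]
      by (simp add: sum.distrib)
    also have "\<dots> = 0"
      using old by (simp add: sum_distrib_left[symmetric])
    finally show ?thesis .
  qed
  show ?case
    by (rule exI[of _ c]) (use old new residual in auto)
qed

text \<open>By homogeneity it is enough to bound the quadratic form on the unit sphere of the
  \<open>\<ell>\<^sup>1\<close> norm.  After coefficients outside \<open>I\<close> are set to 0, that sphere is compact in the
  product topology, so the form attains a positive minimum there.\<close>

lemma positive_definite_coercive:
  fixes G :: "'i \<Rightarrow> 'i \<Rightarrow> real"
  assumes I: "finite I"
    and pos: "\<And>b. \<exists>i\<in>I. b i \<noteq> 0 \<Longrightarrow> (\<Sum>i\<in>I. \<Sum>j\<in>I. b i * b j * G i j) > 0"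
  obtains l where "l > 0"
    "\<And>b. l * (\<Sum>i\<in>I. \<bar>b i\<bar>)\<^sup>2 \<le> (\<Sum>i\<in>I. \<Sum>j\<in>I. b i * b j * G i j)"
proof (cases "I = {}")
  case True
  then show ?thesis using that[of 1] by simp
next
  case False
  define Q where "Q b = (\<Sum>i\<in>I. \<Sum>j\<in>I. b i * b j * G i j)" for b
  define T :: "('i \<Rightarrow> real) set" where "T = Pi\<^sub>E UNIV (\<lambda>i. if i \<in> I then {-1..1} else {0})"
  define S where "S = T \<inter> {b. (\<Sum>i\<in>I. \<bar>b i\<bar>) = 1}"
  have coord: "continuous_on U (\<lambda>b::'i \<Rightarrow> real. b i)" for U i
    by (rule continuous_on_subset[OF continuous_on_product_coordinates]) simp
  have "compactin (product_topology (\<lambda>_. euclidean) UNIV) T"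
    unfolding T_def by (subst compactin_PiE) auto
  then have "compact T"
    by (simp add: euclidean_product_topology)
  moreover have "closed {b. (\<Sum>i\<in>I. \<bar>b i\<bar>) = (1::real)}"
    by (intro closed_Collect_eq continuous_intros coord)
  ultimately have "compact S"
    unfolding S_def by (rule compact_Int_closed)
  have "continuous_on S Q"
    unfolding Q_def by (intro continuous_intros coord)
  obtain i\<^sub>0 where "i\<^sub>0 \<in> I" using False by blast
  have "(\<lambda>i. if i = i\<^sub>0 then 1 else 0) \<in> S"
    using \<open>i\<^sub>0 \<in> I\<close> I by (auto simp: S_def T_def if_distrib[of abs] cong: if_cong)
  then have "S \<noteq> {}" by blast
  then obtain b\<^sub>0 where b0: "b\<^sub>0 \<in> S" "\<And>b. b \<in> S \<Longrightarrow> Q b\<^sub>0 \<le> Q b"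
    using continuous_attains_inf[OF \<open>compact S\<close> _ \<open>continuous_on S Q\<close>] by blast
  have "\<exists>i\<in>I. b\<^sub>0 i \<noteq> 0"
  proof (rule ccontr)
    assume "\<not> ?thesis"
    then show False using b0(1) by (simp add: S_def)
  qed
  then have "Q b\<^sub>0 > 0" unfolding Q_def by (rule pos)
  moreover have "Q b\<^sub>0 * (\<Sum>i\<in>I. \<bar>b i\<bar>)\<^sup>2 \<le> Q b" for b
  proof (cases "(\<Sum>i\<in>I. \<bar>b i\<bar>) = 0")
    case True
    then have "\<forall>i\<in>I. b i = 0" using I by (simp add: sum_nonneg_eq_0_iff)
    then show ?thesis using True by (simp add: Q_def)
  next
    case False
    define s where "s = (\<Sum>i\<in>I. \<bar>b i\<bar>)"
    have "s > 0" using False unfolding s_def by (simp add: sum_nonneg less_le)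
    define c where "c i = (if i \<in> I then b i / s else 0)" for i
    have "(\<Sum>i\<in>I. \<bar>c i\<bar>) = 1"
      using \<open>s > 0\<close> by (simp add: c_def abs_divide sum_divide_distrib[symmetric]) (simp add: s_def)
    moreover have "\<bar>b i\<bar> \<le> s" if "i \<in> I" for i
      unfolding s_def using that I by (intro member_le_sum) auto
    then have "\<bar>c i\<bar> \<le> 1" if "i \<in> I" for i
      using that \<open>s > 0\<close> by (simp add: c_def abs_divide)
    then have "c \<in> T"
      by (auto simp: T_def abs_le_iff minus_le_iff) (simp add: c_def)
    ultimately have "Q b\<^sub>0 \<le> Q c" using b0 by (simp add: S_def)
    also have "Q c = (\<Sum>i\<in>I. \<Sum>j\<in>I. (b i * b j * G i j) / s\<^sup>2)"
      unfolding Q_def by (intro sum.cong) (auto simp: c_def power2_eq_square)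
    also have "\<dots> = Q b / s\<^sup>2"
      by (simp add: Q_def sum_divide_distrib)
    finally show ?thesis
      using \<open>s > 0\<close> by (simp add: s_def[symmetric] field_simps)
  qed
  ultimately show ?thesis using that unfolding Q_def by blast
qed

section \<open>Integrals of bounded continuous functions\<close>

lemma continuous_bounded_set_integrable:
  fixes g :: "real^'D \<Rightarrow> real"
  assumes "open \<Omega>" "bounded \<Omega>" "continuous_on \<Omega> g" "bounded (g ` \<Omega>)"
  shows "set_integrable lebesgue \<Omega> g"
proof -
  obtain B where B: "\<And>y. y \<in> \<Omega> \<Longrightarrow> norm (g y) \<le> B"
    using assms(4) by (auto simp: bounded_iff)
  have "\<Omega> \<in> lmeasurable"
    using assms(1,2) by (simp add: lmeasurable_open)
  then have "integrable (lebesgue_on \<Omega>) g"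
    using B assms(3)
    by (intro finite_measure.integrable_const_bound[OF finite_measure_lebesgue_on, where B = B]
          AE_I2 continuous_imp_measurable_on_sets_lebesgue) (auto simp: fmeasurableD)
  then show ?thesis
    using \<open>\<Omega> \<in> lmeasurable\<close> by (simp add: set_integrable_def integrable_restrict_space)
qed

lemma moment_linear_combination:
  assumes "\<And>i. i \<in> I \<Longrightarrow> set_integrable lebesgue \<Omega> (f i)"
  shows "set_integrable lebesgue \<Omega> (\<lambda>y. \<Sum>i\<in>I. b i * f i y)"
    and "moment \<Omega> (\<lambda>y. \<Sum>i\<in>I. b i * f i y) = (\<Sum>i\<in>I. b i * moment \<Omega> (f i))"
proof -
  have expand: "indicator \<Omega> y *\<^sub>R (\<Sum>i\<in>I. b i * f i y) = (\<Sum>i\<in>I. b i * (indicator \<Omega> y *\<^sub>R f i y))"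
    for y
    by (simp add: sum_distrib_left mult.left_commute)
  show "set_integrable lebesgue \<Omega> (\<lambda>y. \<Sum>i\<in>I. b i * f i y)"
    using assms unfolding set_integrable_def expand
    by (intro Bochner_Integration.integrable_sum integrable_mult_right) auto
  show "moment \<Omega> (\<lambda>y. \<Sum>i\<in>I. b i * f i y) = (\<Sum>i\<in>I. b i * moment \<Omega> (f i))"
    using assms unfolding moment_def set_lebesgue_integral_def set_integrable_def expand
    by (subst Bochner_Integration.integral_sum) auto
qed

lemma moment_cong:
  assumes "\<And>y. y \<in> \<Omega> \<Longrightarrow> f y = g y"
  shows "moment \<Omega> f = moment \<Omega> g"
  unfolding moment_def set_lebesgue_integral_def
  by (intro Bochner_Integration.integral_cong) (auto simp: assms indicator_def)

text \<open>The set where a continuous function does not vanish is open, so it is not negligible unless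
  it is empty.\<close>

lemma moment_square_pos:
  fixes g :: "real^'D \<Rightarrow> real"
  assumes "open \<Omega>" "continuous_on \<Omega> g" and int: "set_integrable lebesgue \<Omega> (\<lambda>y. (g y)\<^sup>2)"
    and "\<exists>y\<in>\<Omega>. g y \<noteq> 0"
  shows "moment \<Omega> (\<lambda>y. (g y)\<^sup>2) > 0"
proof -
  have nonneg: "moment \<Omega> (\<lambda>y. (g y)\<^sup>2) \<ge> 0"
    unfolding moment_def set_lebesgue_integral_def by (intro Bochner_Integration.integral_nonneg) auto
  moreover have "moment \<Omega> (\<lambda>y. (g y)\<^sup>2) \<noteq> 0"
  proof
    assume "moment \<Omega> (\<lambda>y. (g y)\<^sup>2) = 0"
    then have "AE y in lebesgue. indicator \<Omega> y *\<^sub>R (g y)\<^sup>2 = 0"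
      using int unfolding moment_def set_lebesgue_integral_def set_integrable_def
      by (subst (asm) integral_nonneg_eq_0_iff_AE) auto
    then have "AE y in lebesgue. y \<notin> {y\<in>\<Omega>. g y \<noteq> 0}"
      by (rule eventually_mono) (auto simp: indicator_def split: if_splits)
    moreover have open_set: "open {y\<in>\<Omega>. g y \<noteq> 0}"
      using continuous_open_preimage[OF assms(2,1), of "- {0}"]
      by (simp add: vimage_def Int_def open_Compl)
    ultimately have "negligible {y\<in>\<Omega>. g y \<noteq> 0}"
      by (simp add: negligible_iff_null_sets AE_iff_null_sets del: mem_Collect_eq)
    then show False
      using open_not_negligible[OF open_set] assms(4) by blast
  qed
  ultimately show ?thesis by linarith
qed

lemma equidistributed_continuous:
  fixes g :: "real^'D \<Rightarrow> real"
  assumes "open \<Omega>" "equidistributed x \<Omega>" "continuous_on \<Omega> g" "bounded (g ` \<Omega>)"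
  shows "(\<lambda>N. measure lebesgue \<Omega> / real N * (\<Sum>n=1..N. g (x n))) \<longlonglongrightarrow> moment \<Omega> g"
proof -
  have "g \<in> borel_measurable (lebesgue_on \<Omega>)"
    using assms by (intro continuous_imp_measurable_on_sets_lebesgue) auto
  moreover have "AE y in lebesgue_on \<Omega>. continuous (at y within \<Omega>) g"
    using assms(3) by (intro AE_I2) (auto simp: continuous_on_eq_continuous_within)
  ultimately show ?thesis
    using assms(2,4) unfolding equidistributed_def by blast
qed

section \<open>Nonnegativity of the least-squares weights\<close>

text \<open>The hypothesis on \<open>b\<close> says that the combination \<open>P b\<close> represents evaluation at \<open>x m\<close> for the
  unnormalised discrete inner product, so \<open>moment \<Omega> (P b)\<close> is the \<open>m\<close>-th weight of the
  least-squares cubature formula.  With \<open>s\<close> the \<open>\<ell>\<^sup>1\<close> norm of \<open>b\<close>, \<open>V\<close> the volume, \<open>l\<close> the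
  coercivity constant of the Gram matrix \<open>M\<close> and \<open>B\<close> a common bound of the family, the
  discrete mean square of \<open>P b\<close> gives \<open>l/2 s\<^sup>2 \<le> V/N B s\<close>, hence \<open>s \<le> 2 B V / (l N)\<close>.  The
  weight differs from \<open>V/N\<close> by at most \<open>\<eta> s\<close>, with \<open>\<eta>\<close> the error on the members of the
  family.\<close>

lemma least_squares_weights_nonneg:
  fixes \<Omega> :: "(real^'D) set" and p :: "'i \<Rightarrow> real^'D \<Rightarrow> real"
  assumes dom: "open \<Omega>" "bounded \<Omega>" and equi: "equidistributed x \<Omega>"
    and I: "finite I"
    and cont: "\<And>k. k \<in> I \<Longrightarrow> continuous_on \<Omega> (p k)"
    and bdd: "\<And>k. k \<in> I \<Longrightarrow> bounded (p k ` \<Omega>)"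
    and indep: "\<And>b. \<forall>y\<in>\<Omega>. (\<Sum>k\<in>I. b k * p k y) = 0 \<Longrightarrow> \<forall>k\<in>I. b k = 0"
    and one: "\<forall>y\<in>\<Omega>. (\<Sum>k\<in>I. e k * p k y) = 1"
  shows "\<exists>N\<^sub>0. \<forall>N\<ge>N\<^sub>0. \<forall>m\<in>{1..N}. \<forall>b.
    (\<forall>k\<in>I. (\<Sum>n=1..N. (\<Sum>j\<in>I. b j * p j (x n)) * p k (x n)) = p k (x m)) \<longrightarrow>
    moment \<Omega> (\<lambda>y. \<Sum>j\<in>I. b j * p j y) \<ge> 0"
proof -
  have x: "x n \<in> \<Omega>" if "n \<ge> 1" for n
    using equi that by (simp add: equidistributed_def)
  define V where "V = measure lebesgue \<Omega>"
  have "V \<ge> 0" by (simp add: V_def)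
  define P where "P b y = (\<Sum>j\<in>I. b j * p j y)" for b y
  define M where "M i j = moment \<Omega> (\<lambda>y. p i y * p j y)" for i j
  define S where "S N i j = V / real N * (\<Sum>n=1..N. p i (x n) * p j (x n))" for N i j
  have prod_bdd: "bounded ((\<lambda>y. p i y * p j y) ` \<Omega>)" if "i \<in> I" "j \<in> I" for i j
  proof -
    obtain A B where A: "\<And>y. y \<in> \<Omega> \<Longrightarrow> \<bar>p i y\<bar> \<le> A" and B: "\<And>y. y \<in> \<Omega> \<Longrightarrow> \<bar>p j y\<bar> \<le> B"
      using bdd[OF \<open>i \<in> I\<close>] bdd[OF \<open>j \<in> I\<close>] by (auto simp: bounded_iff)
    have "\<bar>p i y * p j y\<bar> \<le> A * B" if "y \<in> \<Omega>" for y
      using mult_mono'[OF A[OF that] B[OF that]] by (simp add: abs_mult)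
    then show ?thesis by (auto simp: bounded_iff)
  qed
  have int: "set_integrable lebesgue \<Omega> (p k)" if "k \<in> I" for k
    using that by (intro continuous_bounded_set_integrable dom cont bdd)
  have prod_int: "set_integrable lebesgue \<Omega> (\<lambda>y. p i y * p j y)" if "i \<in> I" "j \<in> I" for i j
    using that by (intro continuous_bounded_set_integrable dom prod_bdd continuous_intros cont)
  have square: "(P b y)\<^sup>2 = (\<Sum>(i, j)\<in>I \<times> I. (b i * b j) * (p i y * p j y))" for b y
    unfolding P_def power2_eq_square sum_product sum.cartesian_product
    by (intro sum.cong) (auto simp: mult_ac)
  have square_int: "set_integrable lebesgue \<Omega> (\<lambda>y. (P b y)\<^sup>2)" for b
    unfolding square split_beta
    by (rule moment_linear_combination(1)[where f = "\<lambda>z y. p (fst z) y * p (snd z) y"])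
      (auto intro: prod_int)
  have square_moment: "moment \<Omega> (\<lambda>y. (P b y)\<^sup>2) = (\<Sum>i\<in>I. \<Sum>j\<in>I. b i * b j * M i j)" for b
    unfolding square split_beta M_def sum.cartesian_product
    by (rule moment_linear_combination(2)[where f = "\<lambda>z y. p (fst z) y * p (snd z) y"])
      (auto intro: prod_int)
  obtain l where "l > 0"
    and coercive: "\<And>b. l * (\<Sum>i\<in>I. \<bar>b i\<bar>)\<^sup>2 \<le> (\<Sum>i\<in>I. \<Sum>j\<in>I. b i * b j * M i j)"
  proof (rule positive_definite_coercive[OF I, of M])
    fix b assume "\<exists>i\<in>I. b i \<noteq> (0::real)"
    then have "\<exists>y\<in>\<Omega>. P b y \<noteq> 0"
      using indep[of b] unfolding P_def by blast
    moreover have "continuous_on \<Omega> (P b)"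
      unfolding P_def by (intro continuous_intros cont)
    ultimately show "(\<Sum>i\<in>I. \<Sum>j\<in>I. b i * b j * M i j) > 0"
      using moment_square_pos[OF dom(1) _ square_int] square_moment by simp
  qed blast
  have "bounded (\<Union>k\<in>I. p k ` \<Omega>)"
    using I bdd by (intro bounded_UN) auto
  then obtain B where "B > 0" and B: "\<And>k y. k \<in> I \<Longrightarrow> y \<in> \<Omega> \<Longrightarrow> \<bar>p k y\<bar> \<le> B"
    unfolding bounded_pos by (auto simp: real_norm_def)
  \<comment> \<open>The tolerance for the quadrature errors of the basis functions is the value for which the
    last estimate below closes exactly.\<close>
  define \<eta> where "\<eta> = l / (2 * B)"
  have "\<eta> > 0" using \<open>l > 0\<close> \<open>B > 0\<close> by (simp add: \<eta>_def)
  have ev_gram: "\<forall>\<^sub>F N in sequentially. \<forall>i\<in>I. \<forall>j\<in>I. \<bar>S N i j - M i j\<bar> < l / 2"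
  proof (intro eventually_ball_finite ballI I)
    fix i j assume "i \<in> I" "j \<in> I"
    then have "(\<lambda>N. S N i j) \<longlonglongrightarrow> M i j"
      unfolding S_def M_def V_def
      by (intro equidistributed_continuous dom equi prod_bdd continuous_intros cont)
    moreover have "l / 2 > 0" using \<open>l > 0\<close> by simp
    ultimately show "\<forall>\<^sub>F N in sequentially. \<bar>S N i j - M i j\<bar> < l / 2"
      unfolding dist_real_def[symmetric] by (rule tendstoD)
  qed
  have ev_mean: "\<forall>\<^sub>F N in sequentially.
      \<forall>k\<in>I. \<bar>V / real N * (\<Sum>n=1..N. p k (x n)) - moment \<Omega> (p k)\<bar> < \<eta>"
  proof (intro eventually_ball_finite ballI I)
    fix k assume "k \<in> I"
    then have "(\<lambda>N. V / real N * (\<Sum>n=1..N. p k (x n))) \<longlonglongrightarrow> moment \<Omega> (p k)"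
      unfolding V_def by (intro equidistributed_continuous dom equi bdd cont)
    then show "\<forall>\<^sub>F N in sequentially. \<bar>V / real N * (\<Sum>n=1..N. p k (x n)) - moment \<Omega> (p k)\<bar> < \<eta>"
      unfolding dist_real_def[symmetric] using \<open>\<eta> > 0\<close> by (rule tendstoD)
  qed
  obtain N\<^sub>0 where gram: "\<And>N i j. N \<ge> N\<^sub>0 \<Longrightarrow> i \<in> I \<Longrightarrow> j \<in> I \<Longrightarrow> \<bar>S N i j - M i j\<bar> \<le> l / 2"
    and mean: "\<And>N k. N \<ge> N\<^sub>0 \<Longrightarrow> k \<in> I \<Longrightarrow>
      \<bar>V / real N * (\<Sum>n=1..N. p k (x n)) - moment \<Omega> (p k)\<bar> \<le> \<eta>"
    using eventually_conj[OF ev_gram ev_mean] unfolding eventually_sequentially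
    by (meson less_imp_le)
  show ?thesis
  proof (intro exI[of _ N\<^sub>0] allI ballI impI)
    fix N m b
    assume N: "N \<ge> N\<^sub>0" and m: "m \<in> {1..N}"
      and "\<forall>k\<in>I. (\<Sum>n=1..N. (\<Sum>j\<in>I. b j * p j (x n)) * p k (x n)) = p k (x m)"
    then have rep: "(\<Sum>n=1..N. P b (x n) * p k (x n)) = p k (x m)" if "k \<in> I" for k
      using that by (simp add: P_def)
    have rep_comb: "(\<Sum>n=1..N. P b (x n) * P c (x n)) = P c (x m)" for c
    proof -
      have "(\<Sum>n=1..N. P b (x n) * P c (x n)) = (\<Sum>n=1..N. \<Sum>k\<in>I. c k * (P b (x n) * p k (x n)))"
        unfolding P_def[of c] by (simp add: sum_distrib_left mult.left_commute)
      also have "\<dots> = (\<Sum>k\<in>I. c k * (\<Sum>n=1..N. P b (x n) * p k (x n)))"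
        by (subst sum.swap) (simp add: sum_distrib_left)
      also have "\<dots> = P c (x m)"
        using rep by (simp add: P_def)
      finally show ?thesis .
    qed
    define s where "s = (\<Sum>i\<in>I. \<bar>b i\<bar>)"
    have "s \<ge> 0" by (simp add: s_def sum_nonneg)
    have "real N > 0" using m by simp
    have mass: "(\<Sum>n=1..N. P b (x n)) = 1"
    proof -
      have "P e (x n) = 1" if "n \<ge> 1" for n
        using one x[OF that] by (simp add: P_def)
      then show ?thesis using rep_comb[of e] m by simp
    qed
    have discrete_square: "(\<Sum>i\<in>I. \<Sum>j\<in>I. b i * b j * S N i j) = V / real N * P b (x m)"
    proof -
      have "(\<Sum>i\<in>I. \<Sum>j\<in>I. b i * b j * S N i j)
          = (\<Sum>z\<in>I \<times> I. b (fst z) * b (snd z) * S N (fst z) (snd z))"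
        by (simp add: sum.cartesian_product split_beta)
      also have "\<dots> = (\<Sum>z\<in>I \<times> I. \<Sum>n=1..N. V / real N * (b (fst z) * b (snd z) * (p (fst z) (x n) * p (snd z) (x n))))"
        unfolding S_def sum_distrib_left by (intro sum.cong refl) (simp only: mult_ac)
      also have "\<dots> = V / real N * (\<Sum>n=1..N. (P b (x n))\<^sup>2)"
        unfolding square split_beta by (subst sum.swap) (simp add: sum_distrib_left)
      also have "(\<Sum>n=1..N. (P b (x n))\<^sup>2) = P b (x m)"
        using rep_comb[of b] by (simp add: power2_eq_square)
      finally show ?thesis .
    qed
    have perturb: "(\<Sum>i\<in>I. \<Sum>j\<in>I. b i * b j * M i j)
        \<le> (\<Sum>i\<in>I. \<Sum>j\<in>I. b i * b j * S N i j) + l / 2 * s\<^sup>2"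
    proof -
      have "(\<Sum>i\<in>I. \<Sum>j\<in>I. b i * b j * M i j)
          \<le> (\<Sum>i\<in>I. \<Sum>j\<in>I. b i * b j * S N i j + l / 2 * (\<bar>b i\<bar> * \<bar>b j\<bar>))"
      proof (intro sum_mono)
        fix i j assume "i \<in> I" "j \<in> I"
        have "b i * b j * (M i j - S N i j) \<le> \<bar>b i * b j\<bar> * \<bar>M i j - S N i j\<bar>"
          by (metis abs_ge_self abs_mult)
        also have "\<dots> \<le> \<bar>b i * b j\<bar> * (l / 2)"
          using gram[OF N \<open>i \<in> I\<close> \<open>j \<in> I\<close>] by (intro mult_left_mono) (auto simp: abs_minus_commute)
        finally show "b i * b j * M i j \<le> b i * b j * S N i j + l / 2 * (\<bar>b i\<bar> * \<bar>b j\<bar>)"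
          by (simp add: algebra_simps abs_mult)
      qed
      also have "\<dots> = (\<Sum>i\<in>I. \<Sum>j\<in>I. b i * b j * S N i j) + l / 2 * s\<^sup>2"
        unfolding s_def power2_eq_square sum_product by (simp add: sum.distrib sum_distrib_left)
      finally show ?thesis .
    qed
    have "P b (x m) \<le> B * s"
    proof -
      have "P b (x m) \<le> (\<Sum>j\<in>I. \<bar>b j\<bar> * B)"
        unfolding P_def
      proof (intro sum_mono)
        fix j assume "j \<in> I"
        have "b j * p j (x m) \<le> \<bar>b j\<bar> * \<bar>p j (x m)\<bar>"
          by (metis abs_ge_self abs_mult)
        also have "\<dots> \<le> \<bar>b j\<bar> * B"
          using B \<open>j \<in> I\<close> x m by (intro mult_left_mono) auto
        finally show "b j * p j (x m) \<le> \<bar>b j\<bar> * B" .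
      qed
      then show ?thesis by (simp add: s_def sum_distrib_left mult.commute)
    qed
    then have "V / real N * P b (x m) \<le> V / real N * (B * s)"
      using \<open>V \<ge> 0\<close> by (intro mult_left_mono) auto
    moreover have "l * s\<^sup>2 \<le> V / real N * P b (x m) + l / 2 * s\<^sup>2"
      using coercive[of b] perturb unfolding discrete_square s_def by (rule order.trans)
    ultimately have "l / 2 * s\<^sup>2 \<le> V / real N * (B * s)"
      by linarith
    then have "s * (l / 2 * s) \<le> s * (V / real N * B)"
      by (simp add: power2_eq_square algebra_simps)
    then have "l / 2 * s \<le> V / real N * B"
    proof (cases "s = 0")
      case True
      then show ?thesis using \<open>V \<ge> 0\<close> \<open>B > 0\<close> by simp
    next
      case False
      then have "s > 0" using \<open>s \<ge> 0\<close> by simp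
      with \<open>s * (l / 2 * s) \<le> s * (V / real N * B)\<close> show ?thesis
        by (rule mult_left_le_imp_le)
    qed
    then have small: "\<eta> * s \<le> V / real N"
      using \<open>B > 0\<close> by (simp add: \<eta>_def field_simps)
    have "V / real N - \<eta> * s \<le> moment \<Omega> (P b)"
    proof -
      have "V / real N = V / real N * (\<Sum>n=1..N. P b (x n))"
        using mass by simp
      also have "\<dots> = (\<Sum>k\<in>I. b k * (V / real N * (\<Sum>n=1..N. p k (x n))))"
        unfolding P_def sum_distrib_left
        by (subst sum.swap) (simp add: mult_ac)
      also have "\<dots> \<le> (\<Sum>k\<in>I. b k * moment \<Omega> (p k) + \<bar>b k\<bar> * \<eta>)"
      proof (intro sum_mono)
        fix k assume "k \<in> I"
        let ?d = "V / real N * (\<Sum>n=1..N. p k (x n)) - moment \<Omega> (p k)"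
        have "b k * ?d \<le> \<bar>b k\<bar> * \<bar>?d\<bar>"
          by (metis abs_ge_self abs_mult)
        also have "\<dots> \<le> \<bar>b k\<bar> * \<eta>"
          using mean[OF N \<open>k \<in> I\<close>] by (intro mult_left_mono) auto
        finally show "b k * (V / real N * (\<Sum>n=1..N. p k (x n))) \<le> b k * moment \<Omega> (p k) + \<bar>b k\<bar> * \<eta>"
          by (simp add: right_diff_distrib)
      qed
      also have "\<dots> = moment \<Omega> (P b) + \<eta> * s"
        using moment_linear_combination(2)[where I = I and f = p and b = b, OF int]
        by (simp add: P_def[abs_def] sum.distrib s_def sum_distrib_left mult.commute)
      finally show ?thesis by simp
    qed
    then show "moment \<Omega> (\<lambda>y. \<Sum>j\<in>I. b j * p j y) \<ge> 0"
      using small by (simp add: P_def[abs_def])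
  qed
qed

section \<open>Polynomials\<close>

lemma polys_on_continuous_bounded:
  fixes \<Omega> :: "(real^'D) set"
  assumes "bounded \<Omega>" "p \<in> polys_on d \<Omega>"
  shows "continuous_on \<Omega> p" "bounded (p ` \<Omega>)"
proof -
  obtain a where a: "\<And>y. y \<in> \<Omega> \<Longrightarrow>
      p y = (\<Sum>\<gamma> | sum \<gamma> UNIV \<le> d. a \<gamma> * (\<Prod>i\<in>UNIV. (y $ i) ^ \<gamma> i))"
    using assms(2) by (auto simp: polys_on_def)
  let ?P = "\<lambda>y::real^'D. \<Sum>\<gamma> | sum \<gamma> UNIV \<le> d. a \<gamma> * (\<Prod>i\<in>UNIV. (y $ i) ^ \<gamma> i)"
  have P: "continuous_on T ?P" for T by (intro continuous_intros)
  show "continuous_on \<Omega> p"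
    using P a by (simp cong: continuous_on_cong)
  have "bounded (?P ` closure \<Omega>)"
    using assms(1) by (intro compact_imp_bounded compact_continuous_image P) (simp add: compact_closure)
  then show "bounded (p ` \<Omega>)"
    by (rule bounded_subset) (use a closure_subset in \<open>force simp: image_iff\<close>)
qed

lemma one_in_polys_on: "(\<lambda>_. 1) \<in> polys_on d (\<Omega> :: (real^'D) set)"
proof -
  have "finite {\<gamma> :: 'D \<Rightarrow> nat. sum \<gamma> UNIV \<le> d}"
  proof (rule finite_subset)
    show "{\<gamma> :: 'D \<Rightarrow> nat. sum \<gamma> UNIV \<le> d} \<subseteq> PiE UNIV (\<lambda>_. {..d})"
    proof
      fix \<gamma> :: "'D \<Rightarrow> nat" assume "\<gamma> \<in> {\<gamma>. sum \<gamma> UNIV \<le> d}"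
      then have "\<gamma> i \<le> d" for i
        using member_le_sum[of i UNIV \<gamma>] by simp
      then show "\<gamma> \<in> PiE UNIV (\<lambda>_. {..d})" by (simp add: PiE_iff)
    qed
  qed (simp add: finite_PiE)
  then have "1 = (\<Sum>\<gamma> :: 'D \<Rightarrow> nat | sum \<gamma> UNIV \<le> d.
      (if \<gamma> = (\<lambda>_. 0) then 1 else 0) * (\<Prod>i\<in>UNIV. (y $ i) ^ \<gamma> i))" for y :: "real^'D"
    by (simp add: if_distrib[of "\<lambda>t. t * _"] cong: if_cong)
  then show ?thesis
    unfolding polys_on_def
    by (intro CollectI exI[of _ "\<lambda>\<gamma>. if \<gamma> = (\<lambda>_. 0) then 1 else 0"]) blast
qed

lemma polys_on_linear_combination:
  assumes "\<And>k. k \<in> I \<Longrightarrow> p k \<in> polys_on d \<Omega>"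
  shows "(\<lambda>y. \<Sum>k\<in>I. b k * p k y) \<in> polys_on d \<Omega>"
proof -
  have "\<forall>k\<in>I. \<exists>a. \<forall>y\<in>\<Omega>. p k y = (\<Sum>\<gamma> | sum \<gamma> UNIV \<le> d. a \<gamma> * (\<Prod>i\<in>UNIV. (y $ i) ^ \<gamma> i))"
    using assms by (auto simp: polys_on_def)
  then obtain a where a: "\<And>k y. k \<in> I \<Longrightarrow> y \<in> \<Omega> \<Longrightarrow>
      p k y = (\<Sum>\<gamma> | sum \<gamma> UNIV \<le> d. a k \<gamma> * (\<Prod>i\<in>UNIV. (y $ i) ^ \<gamma> i))"
    by (auto dest!: bchoice)
  have "(\<Sum>k\<in>I. b k * p k y)
      = (\<Sum>\<gamma> | sum \<gamma> UNIV \<le> d. (\<Sum>k\<in>I. b k * a k \<gamma>) * (\<Prod>i\<in>UNIV. (y $ i) ^ \<gamma> i))"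
    if "y \<in> \<Omega>" for y
  proof -
    have "(\<Sum>k\<in>I. b k * p k y)
        = (\<Sum>k\<in>I. \<Sum>\<gamma> | sum \<gamma> UNIV \<le> d. b k * a k \<gamma> * (\<Prod>i\<in>UNIV. (y $ i) ^ \<gamma> i))"
      using a that by (intro sum.cong) (auto simp: sum_distrib_left mult.assoc)
    also have "\<dots> = (\<Sum>\<gamma> | sum \<gamma> UNIV \<le> d. (\<Sum>k\<in>I. b k * a k \<gamma>) * (\<Prod>i\<in>UNIV. (y $ i) ^ \<gamma> i))"
      by (subst sum.swap) (simp add: sum_distrib_right)
    finally show ?thesis .
  qed
  then show ?thesis
    unfolding polys_on_def by (intro CollectI exI[of _ "\<lambda>\<gamma>. \<Sum>k\<in>I. b k * a k \<gamma>"]) blast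
qed

text \<open>The conclusion speaks of the space of polynomials rather than of a basis, so that one
  threshold serves all bases.\<close>

lemma polynomial_least_squares_weights_nonneg:
  fixes \<Omega> :: "(real^'D) set"
  assumes dom: "open \<Omega>" "bounded \<Omega>" and equi: "equidistributed x \<Omega>"
    and basis: "poly_basis d \<Omega> K p"
  shows "\<exists>N\<^sub>0. \<forall>N\<ge>N\<^sub>0. \<forall>m\<in>{1..N}. \<forall>q\<in>polys_on d \<Omega>.
    (\<forall>r\<in>polys_on d \<Omega>. (\<Sum>n=1..N. q (x n) * r (x n)) = r (x m)) \<longrightarrow> moment \<Omega> q \<ge> 0"
proof -
  have p: "\<And>k. k \<in> {1..K} \<Longrightarrow> p k \<in> polys_on d \<Omega>"
    and indep: "\<And>b. \<forall>y\<in>\<Omega>. (\<Sum>k=1..K. b k * p k y) = 0 \<Longrightarrow> \<forall>k\<in>{1..K}. b k = 0"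
    and span: "\<And>q. q \<in> polys_on d \<Omega> \<Longrightarrow> \<exists>b. \<forall>y\<in>\<Omega>. q y = (\<Sum>k=1..K. b k * p k y)"
    using basis unfolding poly_basis_def by blast+
  have x: "x n \<in> \<Omega>" if "n \<ge> 1" for n
    using equi that by (simp add: equidistributed_def)
  obtain e where "\<forall>y\<in>\<Omega>. (\<Sum>k=1..K. e k * p k y) = 1"
    using span[OF one_in_polys_on] by metis
  then obtain N\<^sub>0 where N0: "\<forall>N\<ge>N\<^sub>0. \<forall>m\<in>{1..N}. \<forall>b.
      (\<forall>k\<in>{1..K}. (\<Sum>n=1..N. (\<Sum>j=1..K. b j * p j (x n)) * p k (x n)) = p k (x m)) \<longrightarrow>
      moment \<Omega> (\<lambda>y. \<Sum>j=1..K. b j * p j y) \<ge> 0"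
    using least_squares_weights_nonneg[where I = "{1..K}" and p = p, OF dom equi
        finite_atLeastAtMost polys_on_continuous_bounded[OF dom(2) p] indep] by blast
  show ?thesis
  proof (intro exI[of _ N\<^sub>0] allI ballI impI)
    fix N m q
    assume N: "N \<ge> N\<^sub>0" "m \<in> {1..N}" and q: "q \<in> polys_on d \<Omega>"
      and rep: "\<forall>r\<in>polys_on d \<Omega>. (\<Sum>n=1..N. q (x n) * r (x n)) = r (x m)"
    obtain b where b: "\<And>y. y \<in> \<Omega> \<Longrightarrow> q y = (\<Sum>j=1..K. b j * p j y)"
      using span[OF q] by blast
    have "(\<Sum>n=1..N. (\<Sum>j=1..K. b j * p j (x n)) * p k (x n)) = p k (x m)" if "k \<in> {1..K}" for k
    proof -
      have "(\<Sum>n=1..N. (\<Sum>j=1..K. b j * p j (x n)) * p k (x n)) = (\<Sum>n=1..N. q (x n) * p k (x n))"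
        using b x by (intro sum.cong) auto
      then show ?thesis using rep p[OF that] by simp
    qed
    then have "moment \<Omega> (\<lambda>y. \<Sum>j=1..K. b j * p j y) \<ge> 0"
      using N0 N by blast
    then show "moment \<Omega> q \<ge> 0"
      using moment_cong[of \<Omega> q, OF b] by simp
  qed
qed

section \<open>Radial basis functions with nonoverlapping supports\<close>

text \<open>The function \<open>\<phi>\<close> may have zeros inside \<open>[0, 1]\<close>, but the points where it is nonzero are dense
  there.  Moving a point of the ball along its ray from the center reaches radii at which \<open>\<phi>\<close>
  is nonzero, so the support fills the whole ball within \<open>\<Omega>\<close>.\<close>

lemma ball_subset_interior_supp_rbf:
  fixes \<Omega> :: "(real^'D) set"
  assumes "open \<Omega>" and R3: "supp {0..} \<phi> = {0..1}" and "e n > 0"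
  shows "\<Omega> \<inter> ball (x n) (1 / e n) \<subseteq> interior (supp \<Omega> (rbf \<phi> e x n))"
proof (rule interior_maximal)
  show "open (\<Omega> \<inter> ball (x n) (1 / e n))"
    using assms(1) by blast
  show "\<Omega> \<inter> ball (x n) (1 / e n) \<subseteq> supp \<Omega> (rbf \<phi> e x n)"
  proof
    fix y assume y: "y \<in> \<Omega> \<inter> ball (x n) (1 / e n)"
    define r where "r = e n * norm (y - x n)"
    \<comment> \<open>At the center every direction serves as the ray.\<close>
    obtain u where u: "norm u = 1" "y = x n + (r / e n) *\<^sub>R u"
    proof (cases "y = x n")
      case True
      obtain u :: "real^'D" where "norm u = 1"
        using vector_choose_size[of 1] by auto
      then show ?thesis using that True by (simp add: r_def)
    next
      case False
      then show ?thesis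
        using that[of "(1 / norm (y - x n)) *\<^sub>R (y - x n)"] \<open>e n > 0\<close> by (simp add: r_def)
    qed
    have "norm (y - x n) < 1 / e n"
      using y by (simp add: dist_norm norm_minus_commute)
    then have "e n * norm (y - x n) < 1"
      using \<open>e n > 0\<close> by (simp only: pos_less_divide_eq mult.commute)
    then have "r \<in> {0..1}"
      using \<open>e n > 0\<close> by (simp add: r_def)
    then have "r \<in> supp {0..} \<phi>"
      using R3 by simp
    then have r: "r \<in> closure (support_on {0..} \<phi>)"
      by (simp add: supp_def)
    have "y \<in> closure (support_on \<Omega> (rbf \<phi> e x n))"
      unfolding closure_approachable
    proof (intro allI impI)
      fix \<delta> :: real assume "\<delta> > 0"
      obtain \<rho> where \<rho>: "\<rho> > 0" "ball y \<rho> \<subseteq> \<Omega>"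
        using y \<open>open \<Omega>\<close> by (meson IntD1 openE)
      obtain t where t: "t \<in> support_on {0..} \<phi>" "dist t r < e n * min \<delta> \<rho>"
        using r \<open>\<delta> > 0\<close> \<open>\<rho> > 0\<close> \<open>e n > 0\<close> unfolding closure_approachable
        by (metis min_less_iff_conj mult_pos_pos)
      define z where "z = x n + (t / e n) *\<^sub>R u"
      have "z - y = ((t - r) / e n) *\<^sub>R u"
        by (simp add: z_def u(2) algebra_simps diff_divide_distrib)
      then have "dist z y = dist t r / e n"
        using u(1) \<open>e n > 0\<close> by (simp add: dist_norm)
      then have "e n * dist z y < e n * min \<delta> \<rho>"
        using t(2) \<open>e n > 0\<close> by simp
      then have close: "dist z y < min \<delta> \<rho>"
        using \<open>e n > 0\<close> by (simp only: mult_less_cancel_left_pos)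
      then have "z \<in> \<Omega>"
        using \<rho>(2) by (auto simp: dist_commute)
      moreover have "rbf \<phi> e x n z = \<phi> t"
        using t(1) u(1) \<open>e n > 0\<close> by (simp add: rbf_def z_def support_on_def)
      ultimately have "z \<in> support_on \<Omega> (rbf \<phi> e x n)"
        using t(1) by (simp add: support_on_def)
      then show "\<exists>z\<in>support_on \<Omega> (rbf \<phi> e x n). dist z y < \<delta>"
        using close by auto
    qed
    then show "y \<in> supp \<Omega> (rbf \<phi> e x n)"
      using y by (simp add: supp_def)
  qed
qed

text \<open>Nonoverlap forces distances of centers strictly larger than the support radii.  The
  strictness matters, as \<open>\<phi>\<close> may be nonzero at 1.\<close>

lemma rbf_at_centers:
  fixes \<Omega> :: "(real^'D) set"
  assumes "open \<Omega>" and R3: "supp {0..} \<phi> = {0..1}"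
    and e: "\<And>n. n \<in> {1..N} \<Longrightarrow> e n > 0"
    and nonoverlap: "nonoverlapping_supports \<Omega> (rbf \<phi> e x) N"
    and nm: "n \<in> {1..N}" "m \<in> {1..N}" and "x m \<in> \<Omega>"
  shows "rbf \<phi> e x n (x m) = (if n = m then \<phi> 0 else 0)"
proof (cases "n = m")
  case True
  then show ?thesis by (simp add: rbf_def)
next
  case False
  have "dist (x n) (x m) > 1 / e n"
  proof (rule ccontr)
    \<comment> \<open>Otherwise \<open>x m\<close> lies in the closure of the ball about \<open>x n\<close>, so its own support, which
      contains a neighbourhood of \<open>x m\<close>, reaches into that ball.\<close>
    assume "\<not> ?thesis"
    then have "x m \<in> closure (ball (x n) (1 / e n))"
      using e[OF nm(1)] by simp
    moreover have "open (\<Omega> \<inter> ball (x m) (1 / e m))" "x m \<in> \<Omega> \<inter> ball (x m) (1 / e m)"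
      using \<open>open \<Omega>\<close> \<open>x m \<in> \<Omega>\<close> e[OF nm(2)] by auto
    ultimately obtain z where "z \<in> \<Omega> \<inter> ball (x m) (1 / e m)" "z \<in> ball (x n) (1 / e n)"
      by (meson closure_iff_nhds_not_empty disjoint_iff order.refl)
    then have "z \<in> interior (supp \<Omega> (rbf \<phi> e x n)) \<inter> interior (supp \<Omega> (rbf \<phi> e x m))"
      using ball_subset_interior_supp_rbf[where e = e and x = x, OF \<open>open \<Omega>\<close> R3 e[OF nm(1)]]
        ball_subset_interior_supp_rbf[where e = e and x = x, OF \<open>open \<Omega>\<close> R3 e[OF nm(2)]] by blast
    then show False
      using nonoverlap nm False unfolding nonoverlapping_supports_def by blast
  qed
  then have far: "e n * norm (x n - x m) > 1"
    using e[OF nm(1)] by (simp add: dist_norm field_simps)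
  have "\<phi> (e n * norm (x n - x m)) = 0"
  proof (rule ccontr)
    assume "\<phi> (e n * norm (x n - x m)) \<noteq> 0"
    then have "e n * norm (x n - x m) \<in> supp {0..} \<phi>"
      using far closure_subset by (force simp: supp_def support_on_def)
    then show False using R3 far by simp
  qed
  then show ?thesis using False by (simp add: rbf_def)
qed

section \<open>Stability of the cubature formula\<close>

theorem theorem5p1:
  fixes \<Omega> :: "(real^'D) set"
    and x :: "nat \<Rightarrow> real^'D"
    and \<phi> :: "real \<Rightarrow> real"
    and \<epsilon> :: "nat \<Rightarrow> nat \<Rightarrow> real"
  assumes domain: "open \<Omega>" "connected \<Omega>" "bounded \<Omega>" "measure lebesgue \<Omega> > 0"
    and equidist: "equidistributed x \<Omega>"
    and distinct: "inj_on x {1..}"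
    and R1: "\<forall>r\<ge>0. \<phi> r \<ge> 0"
    and R2: "\<forall>r\<ge>0. \<bar>\<phi> r\<bar> \<le> 1" "\<exists>r\<ge>0. \<bar>\<phi> r\<bar> = 1"
    and R3: "supp {0..} \<phi> = {0..1}"
    and shape_pos: "\<forall>N. \<forall>n\<in>{1..N}. \<epsilon> N n > 0"
    and nonoverlap: "\<forall>N. nonoverlapping_supports \<Omega> (rbf \<phi> (\<epsilon> N) x) N"
    and moments: "\<forall>N. equal_moments \<Omega> (rbf \<phi> (\<epsilon> N) x) N"
  shows "\<forall>d. \<exists>N\<^sub>0. \<forall>N\<ge>N\<^sub>0. \<forall>K p. poly_basis d \<Omega> K p \<longrightarrow>
           (\<phi> 0 \<noteq> 0 \<longrightarrow> (\<exists>c. cardinal_functions \<Omega> x N (rbf \<phi> (\<epsilon> N) x) K p c)) \<and>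
           (\<forall>c. cardinal_functions \<Omega> x N (rbf \<phi> (\<epsilon> N) x) K p c \<longrightarrow>
              stable x N (\<lambda>n. moment \<Omega> (c n)) \<and>
              (\<forall>m\<in>{1..N}. moment \<Omega> (c m) \<ge> 0))"
proof
  fix d
  have x: "x n \<in> \<Omega>" if "n \<ge> 1" for n
    using equidist that by (simp add: equidistributed_def)
  have centers: "rbf \<phi> (\<epsilon> N) x n (x m) = (if n = m then \<phi> 0 else 0)"
    if "n \<in> {1..N}" "m \<in> {1..N}" for N n m
    using that rbf_at_centers[OF domain(1) R3 _ spec[OF nonoverlap] that] shape_pos x by auto
  have existence: "\<exists>c. cardinal_functions \<Omega> x N (rbf \<phi> (\<epsilon> N) x) K p c"
    if "\<phi> 0 \<noteq> 0" for N K and p :: "nat \<Rightarrow> real^'D \<Rightarrow> real"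
  proof -
    have "\<exists>\<beta>. \<forall>m. \<forall>k\<in>{1..K}. (\<Sum>n=1..N.
        ((if m = n then 1 else 0) - (\<Sum>j=1..K. \<beta> m j * p j (x n))) * p k (x n)) = 0"
      by (intro choice allI least_squares_solution_exists) auto
    then obtain \<beta> where \<beta>: "\<And>m k. k \<in> {1..K} \<Longrightarrow> (\<Sum>n=1..N.
        ((if m = n then 1 else 0) - (\<Sum>j=1..K. \<beta> m j * p j (x n))) * p k (x n)) = 0"
      by blast
    define \<alpha> where "\<alpha> m n = ((if m = n then 1 else 0) - (\<Sum>j=1..K. \<beta> m j * p j (x n))) / \<phi> 0"
      for m n
    define c where "c m y = (\<Sum>n=1..N. \<alpha> m n * rbf \<phi> (\<epsilon> N) x n y) + (\<Sum>k=1..K. \<beta> m k * p k y)"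
      for m y
    have "c m (x n) = (if m = n then 1 else 0)" if "n \<in> {1..N}" for m n
    proof -
      have "(\<Sum>i=1..N. \<alpha> m i * rbf \<phi> (\<epsilon> N) x i (x n)) = (\<Sum>i=1..N. if i = n then \<alpha> m i * \<phi> 0 else 0)"
        using centers that by (intro sum.cong) auto
      then show ?thesis
        using that \<open>\<phi> 0 \<noteq> 0\<close> by (simp add: c_def \<alpha>_def)
    qed
    moreover have "(\<Sum>n=1..N. \<alpha> m n * p k (x n)) = 0" if "k \<in> {1..K}" for m k
      using \<beta>[OF that, of m] by (simp add: \<alpha>_def sum_divide_distrib[symmetric])
    ultimately have "cardinal_functions \<Omega> x N (rbf \<phi> (\<epsilon> N) x) K p c"
      unfolding cardinal_functions_def
      by (intro exI[of _ \<alpha>] exI[of _ \<beta>]) (auto simp: c_def)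
    then show ?thesis by blast
  qed
  \<comment> \<open>The threshold precedes the basis in the claim, so it is computed from one fixed basis.\<close>
  have "\<exists>N\<^sub>0. \<forall>N\<ge>N\<^sub>0. (\<exists>K p. poly_basis d \<Omega> K p) \<longrightarrow> (\<forall>m\<in>{1..N}. \<forall>q\<in>polys_on d \<Omega>.
      (\<forall>r\<in>polys_on d \<Omega>. (\<Sum>n=1..N. q (x n) * r (x n)) = r (x m)) \<longrightarrow> moment \<Omega> q \<ge> 0)"
    using polynomial_least_squares_weights_nonneg[OF domain(1,3) equidist] by meson
  then obtain N\<^sub>0 where N0: "\<And>N K p m q. N \<ge> N\<^sub>0 \<Longrightarrow> poly_basis d \<Omega> K p \<Longrightarrow> m \<in> {1..N} \<Longrightarrow>
      q \<in> polys_on d \<Omega> \<Longrightarrow>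
      (\<And>r. r \<in> polys_on d \<Omega> \<Longrightarrow> (\<Sum>n=1..N. q (x n) * r (x n)) = r (x m)) \<Longrightarrow> moment \<Omega> q \<ge> 0"
    by metis
  have nonneg: "moment \<Omega> (c m) \<ge> 0"
    if N: "N \<ge> N\<^sub>0" and basis: "poly_basis d \<Omega> K p"
      and card: "cardinal_functions \<Omega> x N (rbf \<phi> (\<epsilon> N) x) K p c" and m: "m \<in> {1..N}"
    for N K p c m
  proof -
    let ?f = "rbf \<phi> (\<epsilon> N) x"
    obtain \<alpha> \<beta> :: "nat \<Rightarrow> real"
      where c: "\<And>y. y \<in> \<Omega> \<Longrightarrow> c m y = (\<Sum>n=1..N. \<alpha> n * ?f n y) + (\<Sum>k=1..K. \<beta> k * p k y)"
        and delta: "\<And>n. n \<in> {1..N} \<Longrightarrow> c m (x n) = (if m = n then 1 else 0)"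
        and "\<forall>k\<in>{1..K}. (\<Sum>n=1..N. \<alpha> n * p k (x n)) = 0"
      using card m unfolding cardinal_functions_def by blast
    have p: "p k \<in> polys_on d \<Omega>" if "k \<in> {1..K}" for k
      using basis that by (simp add: poly_basis_def)
    define q where "q = (\<lambda>y. \<Sum>k=1..K. \<beta> k * p k y)"
    have q: "q \<in> polys_on d \<Omega>"
      unfolding q_def using p by (rule polys_on_linear_combination)
    have orth: "(\<Sum>n=1..N. \<alpha> n * r (x n)) = 0" if "r \<in> polys_on d \<Omega>" for r
    proof -
      have "\<exists>b. \<forall>y\<in>\<Omega>. r y = (\<Sum>k=1..K. b k * p k y)"
        using basis that by (simp only: poly_basis_def)
      then obtain b where "\<forall>y\<in>\<Omega>. r y = (\<Sum>k=1..K. b k * p k y)" ..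
      then have "(\<Sum>n=1..N. \<alpha> n * r (x n)) = (\<Sum>n=1..N. \<Sum>k=1..K. b k * (\<alpha> n * p k (x n)))"
        using x by (intro sum.cong) (auto simp: sum_distrib_left mult.left_commute)
      also have "\<dots> = (\<Sum>k=1..K. b k * (\<Sum>n=1..N. \<alpha> n * p k (x n)))"
        by (subst sum.swap) (simp add: sum_distrib_left)
      also have "\<dots> = 0"
        using \<open>\<forall>k\<in>{1..K}. (\<Sum>n=1..N. \<alpha> n * p k (x n)) = 0\<close> by simp
      finally show ?thesis .
    qed
    \<comment> \<open>Kept free of division by \<open>\<phi> 0\<close>, so that the case \<open>\<phi> 0 = 0\<close> is covered as well.\<close>
    have q_at: "q (x n) = (if m = n then 1 else 0) - \<phi> 0 * \<alpha> n" if "n \<in> {1..N}" for n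
    proof -
      have "(\<Sum>i=1..N. \<alpha> i * ?f i (x n)) = (\<Sum>i=1..N. if i = n then \<alpha> i * \<phi> 0 else 0)"
        using centers that by (intro sum.cong) auto
      then have "(\<Sum>i=1..N. \<alpha> i * ?f i (x n)) = \<alpha> n * \<phi> 0"
        using that by simp
      then show ?thesis
        using c[of "x n"] delta[OF that] x that by (simp add: q_def)
    qed
    have rep: "(\<Sum>n=1..N. q (x n) * r (x n)) = r (x m)" if "r \<in> polys_on d \<Omega>" for r
    proof -
      have "(\<Sum>n=1..N. q (x n) * r (x n))
          = (\<Sum>n=1..N. (if n = m then r (x n) else 0) - \<phi> 0 * (\<alpha> n * r (x n)))"
      proof (rule sum.cong[OF refl])
        fix n assume "n \<in> {1..N}"
        then show "q (x n) * r (x n) = (if n = m then r (x n) else 0) - \<phi> 0 * (\<alpha> n * r (x n))"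
          by (simp only: q_at) (auto simp: left_diff_distrib)
      qed
      also have "\<dots> = r (x m) - \<phi> 0 * (\<Sum>n=1..N. \<alpha> n * r (x n))"
        using m by (simp add: sum_subtractf sum_distrib_left)
      finally show ?thesis using orth[OF that] by simp
    qed
    have f_int: "set_integrable lebesgue \<Omega> (?f n)" if "n \<in> {1..N}" for n
      using moments that by (simp add: equal_moments_def)
    have f_moment: "moment \<Omega> (?f n) = moment \<Omega> (?f m)" if "n \<in> {1..N}" for n
      using moments that m unfolding equal_moments_def by blast
    have "moment \<Omega> (\<lambda>y. \<Sum>n=1..N. \<alpha> n * ?f n y) = (\<Sum>n=1..N. \<alpha> n * moment \<Omega> (?f n))"
      using f_int by (rule moment_linear_combination(2))
    also have "\<dots> = (\<Sum>n=1..N. \<alpha> n * 1) * moment \<Omega> (?f m)"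
      using f_moment by (simp add: sum_distrib_right)
    also have "\<dots> = 0"
      using orth[OF one_in_polys_on] by simp
    finally have rbf_part: "moment \<Omega> (\<lambda>y. \<Sum>n=1..N. \<alpha> n * ?f n y) = 0" .
    have "moment \<Omega> (c m) = moment \<Omega> (\<lambda>y. (\<Sum>n=1..N. \<alpha> n * ?f n y) + q y)"
      using c by (intro moment_cong) (simp add: q_def)
    also have "\<dots> = moment \<Omega> (\<lambda>y. \<Sum>n=1..N. \<alpha> n * ?f n y) + moment \<Omega> q"
      unfolding moment_def
    proof (rule set_integral_add(2))
      show "set_integrable lebesgue \<Omega> (\<lambda>y. \<Sum>n=1..N. \<alpha> n * ?f n y)"
        using f_int by (rule moment_linear_combination(1))
      show "set_integrable lebesgue \<Omega> q"
        using domain q polys_on_continuous_bounded by (intro continuous_bounded_set_integrable) auto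
    qed
    also have "\<dots> \<ge> 0"
      using rbf_part N0[OF N basis m q rep] by simp
    finally show ?thesis .
  qed
  show "\<exists>N\<^sub>0. \<forall>N\<ge>N\<^sub>0. \<forall>K p. poly_basis d \<Omega> K p \<longrightarrow>
           (\<phi> 0 \<noteq> 0 \<longrightarrow> (\<exists>c. cardinal_functions \<Omega> x N (rbf \<phi> (\<epsilon> N) x) K p c)) \<and>
           (\<forall>c. cardinal_functions \<Omega> x N (rbf \<phi> (\<epsilon> N) x) K p c \<longrightarrow>
              stable x N (\<lambda>n. moment \<Omega> (c n)) \<and>
              (\<forall>m\<in>{1..N}. moment \<Omega> (c m) \<ge> 0))"
    using existence nonneg by (intro exI[of _ N\<^sub>0]) (auto simp: stable_def cubature_def)
qed

end
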